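(* Let $M$ be a complex matrix of order $n$, partitioned as a $k\times k$ block matrix with square diagonal blocks, and let $M=M_D+M_{\mathrm{off}}$ be its decomposition into the block diagonal part $M_D$ and the block off-diagonal part $M_{\mathrm{off}}$. If $M_D$ is non-singular and $\rho\equiv\rho(M_D^{-1}M_{\mathrm{off}})<1$, then $$\frac{|\det(M)-\det(M_D)|}{|\det(M_D)|}\leq c\rho\,e^{c\rho},\qquad\text{where } c\equiv -n\ln(1-\rho).$$ If also $c\rho<1$, then $$\frac{|\det(M)-\det(M_D)|}{|\det(M_D)|}\leq \frac{7}{4}c\rho.$$
   Context: $\rho(A)=\max_j|\lambda_j(A)|$ is the spectral radius of a square matrix $A$ with eigenvalues $\lambda_j(A)$. Given a partition of $M$ as a $k\times k$ block matrix $(M_{ij})_{1\le i,j\le k}$ whose diagonal blocks $M_{jj}$ are square (not necessarily of the same dimension), $M_D$ is the block diagonal matrix with diagonal blocks $M_{11},\dots,M_{kk}$ and zero off-diagonal blocks, and $M_{\mathrm{off}}=M-M_D$ (so $M_{\mathrm{off}}$ has zero diagonal blocks). *)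

theory Defs
  imports Complex_Main "Jordan_Normal_Form.Spectral_Radius"
    "Jordan_Normal_Form.Gauss_Jordan_Elimination" "Jordan_Normal_Form.Determinant"
begin

text \<open>A partition into a block matrix with square diagonal blocks is given by the number k of
  blocks and the sizes \<open>d 0, ..., d (k - 1)\<close> of the diagonal blocks (blocks are numbered from 0).
  The block (i, j) has dimension \<open>d i\<close> times \<open>d j\<close>.\<close>

definition mat_block :: "(nat \<Rightarrow> nat) \<Rightarrow> 'a mat \<Rightarrow> nat \<Rightarrow> nat \<Rightarrow> 'a mat" where
  "mat_block d M i j =
     mat (d i) (d j) (\<lambda>(r, s). M $$ ((\<Sum>l<i. d l) + r, (\<Sum>l<j. d l) + s))"

definition block_diag_part :: "nat \<Rightarrow> (nat \<Rightarrow> nat) \<Rightarrow> 'a :: zero mat \<Rightarrow> 'a mat" where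
  "block_diag_part k d M = diag_block_mat (map (\<lambda>i. mat_block d M i i) [0..<k])"

definition block_off_part :: "nat \<Rightarrow> (nat \<Rightarrow> nat) \<Rightarrow> 'a :: ring mat \<Rightarrow> 'a mat" where
  "block_off_part k d M = M - block_diag_part k d M"

text \<open>Only meaningful for invertible A; otherwise \<open>mat_inverse\<close> yields \<open>None\<close>.\<close>

definition inv_mat :: "'a :: field mat \<Rightarrow> 'a mat" where
  "inv_mat A = the (mat_inverse A)"

end

theory Submission
  imports Defs "HOL-Analysis.Complex_Transcendental"
    "Jordan_Normal_Form.Schur_Decomposition"
begin

text \<open>
  The matrix \<open>A = M_D\<^sup>-\<^sup>1 M_off\<close> has trace zero, because the inverse of a block diagonal matrix is
  block diagonal. Since \<open>det M = det M_D * det (1 + A)\<close>, the relative error is \<open>\<bar>det (1 + A) - 1\<bar>\<close>,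
  and \<open>det (1 + A)\<close> is the product of the \<open>1 + \<lambda>\<close> over the eigenvalues \<open>\<lambda>\<close> of \<open>A\<close>. The eigenvalues
  sum to zero, so \<open>det (1 + A) = exp z\<close> for the sum \<open>z\<close> of the \<open>ln (1 + \<lambda>) - \<lambda>\<close>. The
  logarithm series bounds each summand by \<open>- \<rho> ln (1 - \<rho>)\<close>, whence \<open>\<bar>z\<bar> \<le> c \<rho>\<close>.
\<close>

section \<open>Estimates for the exponential and the logarithm\<close>

lemma norm_exp_minus_one_le:
  fixes z :: "'a :: {banach, real_normed_algebra_1}"
  shows "norm (exp z - 1) \<le> exp (norm z) - 1"
proof -
  let ?f = "\<lambda>x n. x ^ n /\<^sub>R fact n"
  \<comment> \<open>Dropping the constant term of both series leaves a termwise comparison.\<close>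
  have "(\<lambda>n. ?f z (Suc n)) sums (exp z - 1)"
    using sums_split_initial_segment[OF exp_converges[of z], of 1] by simp
  moreover have "(\<lambda>n. ?f (norm z) (Suc n)) sums (exp (norm z) - 1)"
    using sums_split_initial_segment[OF exp_converges[of "norm z"], of 1] by simp
  moreover have "norm (?f z n) \<le> ?f (norm z) n" for n
    using norm_power_ineq[of z n] by (simp add: mult_left_mono)
  ultimately show ?thesis
    using norm_suminf_le[of "\<lambda>n. ?f z (Suc n)" "\<lambda>n. ?f (norm z) (Suc n)"]
    unfolding sums_iff by metis
qed

lemma exp_minus_one_le_mult_exp:
  fixes x :: real
  shows "exp x - 1 \<le> x * exp x"
proof -
  have "(1 - x) * exp x \<le> exp (- x) * exp x"
    using exp_ge_add_one_self[of "- x"] by (intro mult_right_mono) auto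
  then show ?thesis
    by (simp add: algebra_simps flip: exp_add)
qed

text \<open>By convexity, \<open>exp\<close> on [0, 1] lies below its chord, whose slope e - 1 is
  less than 11/4 - 1 = 7/4.\<close>

lemma exp_minus_one_le_linear:
  fixes x :: real
  assumes "0 \<le> x" "x \<le> 1"
  shows "exp x - 1 \<le> 7 / 4 * x"
proof -
  have "exp x \<le> (1 - x) + x * exp 1"
    using convex_onD[OF exp_convex assms, of 0 1] by simp
  also have "\<dots> \<le> (1 - x) + x * (11 / 4)"
    using e_less_272 assms by (intro add_left_mono mult_left_mono) auto
  finally show ?thesis by (simp add: algebra_simps)
qed

text \<open>Without its linear term, the logarithm series at z is dominated termwise by the
  corresponding series of - ln (1 - r) - r.\<close>

lemma norm_Ln_one_plus_minus_self_le:
  fixes z :: complex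
  assumes "norm z \<le> r" "r < 1"
  shows "norm (Ln (1 + z) - z) \<le> - r * ln (1 - r)"
proof -
  \<comment> \<open>The term at n = 0 is a division by zero and hence 0; the subtraction cancels the
    term at n = 1.\<close>
  define a where "a x n = - ((- x) ^ n) / of_nat n - (if n = 1 then x else 0)"
    for x :: complex and n
  define b where "b n = r ^ n / real n - (if n = 1 then r else 0)" for n
  have r: "0 \<le> r" using assms(1) norm_ge_zero[of z] by linarith
  have one_term: "(\<lambda>n. if n = 1 then x else 0) sums x" for x :: "'a :: real_normed_vector"
    using sums_single[of 1 "\<lambda>_. x"] by simp
  have "a z sums (Ln (1 + z) - z)"
    unfolding a_def using assms by (intro sums_diff Ln_series' one_term) auto
  moreover have "b sums (- ln (1 - r) - r)"
  proof -
    have "(\<lambda>n. r ^ n / real n) sums - ln (1 - r)"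
      using sums_minus[OF ln_series'[of "- r"]] r assms(2) by simp
    then show ?thesis unfolding b_def by (intro sums_diff one_term)
  qed
  moreover have "norm (a z n) \<le> b n" for n
    using power_mono[OF assms(1), of n]
    by (auto simp: a_def b_def norm_divide norm_power divide_right_mono)
  ultimately have "norm (Ln (1 + z) - z) \<le> - ln (1 - r) - r"
    using norm_suminf_le[of "a z" b] by (simp add: sums_iff)
  also have "\<dots> \<le> - r * ln (1 - r)"
  proof -
    \<comment> \<open>The claim rearranges to (1 - r) * (- ln (1 - r)) \<le> r, which is ln t \<le>
      t - 1 at t = 1 / (1 - r).\<close>
    have "- ln (1 - r) \<le> 1 / (1 - r) - 1"
      using ln_le_minus_one[of "1 / (1 - r)"] assms(2) by (simp add: ln_div)
    then have "(1 - r) * (- ln (1 - r)) \<le> (1 - r) * (1 / (1 - r) - 1)"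
      using assms(2) by (intro mult_left_mono) auto
    also have "\<dots> = r" using assms(2) by (simp add: field_simps)
    finally show ?thesis by (simp add: algebra_simps)
  qed
  finally show ?thesis .
qed

text \<open>The vanishing sum lets \<open>f i\<close> be subtracted for free in the exponent, which
  removes its first-order part.\<close>

lemma prod_one_plus_eq_exp_sum:
  fixes f :: "'a \<Rightarrow> complex"
  assumes "(\<Sum>i\<in>I. f i) = 0" "\<And>i. i \<in> I \<Longrightarrow> norm (f i) < 1"
  shows "(\<Prod>i\<in>I. 1 + f i) = exp (\<Sum>i\<in>I. Ln (1 + f i) - f i)"
proof (cases "finite I")
  case True
  have "1 + f i \<noteq> 0" if "i \<in> I" for i
    using assms(2)[OF that] by (metis add_eq_0_iff norm_minus_cancel norm_one less_irrefl)
  then have "(\<Prod>i\<in>I. 1 + f i) = exp (\<Sum>i\<in>I. Ln (1 + f i))"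
    using True by (simp add: exp_sum)
  with assms(1) show ?thesis by (simp add: sum_subtractf)
\<comment> \<open>For infinite \<open>I\<close> both sides are 1 by the default values of product
  and sum.\<close>
qed simp

section \<open>Trace, similarity and eigenvalues\<close>

lemma sum_diag_mult_commute:
  fixes A B :: "'a :: comm_semiring_0 mat"
  assumes "A \<in> carrier_mat m n" "B \<in> carrier_mat n m"
  shows "(\<Sum>i<m. (A * B) $$ (i, i)) = (\<Sum>i<n. (B * A) $$ (i, i))"
proof -
  have "(\<Sum>i<m. (A * B) $$ (i, i)) = (\<Sum>i<m. \<Sum>j<n. A $$ (i, j) * B $$ (j, i))"
    using assms by (intro sum.cong) (auto simp: scalar_prod_def atLeast0LessThan)
  also have "\<dots> = (\<Sum>j<n. \<Sum>i<m. B $$ (j, i) * A $$ (i, j))"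
    by (subst sum.swap) (simp add: mult.commute)
  also have "\<dots> = (\<Sum>i<n. (B * A) $$ (i, i))"
    using assms by (intro sum.cong) (auto simp: scalar_prod_def atLeast0LessThan)
  finally show ?thesis .
qed

lemma sum_diag_similar:
  fixes A B :: "'a :: comm_ring_1 mat"
  assumes "A \<in> carrier_mat n n" "similar_mat A B"
  shows "(\<Sum>i<n. A $$ (i, i)) = (\<Sum>i<n. B $$ (i, i))"
proof -
  from assms(2) obtain P Q where "similar_mat_wit A B P Q"
    unfolding similar_mat_def by blast
  note wit = similar_mat_witD2[OF assms(1) this]
  have "(\<Sum>i<n. A $$ (i, i)) = (\<Sum>i<n. (Q * (P * B)) $$ (i, i))"
    using wit by (subst wit(3), subst sum_diag_mult_commute[of "P * B" n n Q]) auto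
  also have "Q * (P * B) = B"
    using wit by (simp flip: assoc_mult_mat[of Q n n P n B n])
  finally show ?thesis .
qed

lemma similar_mat_one_plus:
  fixes A B :: "'a :: comm_ring_1 mat"
  assumes "A \<in> carrier_mat n n" "similar_mat A B"
  shows "similar_mat (1\<^sub>m n + A) (1\<^sub>m n + B)"
proof -
  from assms(2) obtain P Q where "similar_mat_wit A B P Q"
    unfolding similar_mat_def by blast
  note wit = similar_mat_witD2[OF assms(1) this]
  have "P * (1\<^sub>m n + B) * Q = (P + P * B) * Q"
    using wit by (subst mult_add_distrib_mat[of P n n _ n]) auto
  also have "\<dots> = 1\<^sub>m n + A"
    using wit by (subst add_mult_distrib_mat[of _ n n]) auto
  finally have "similar_mat_wit (1\<^sub>m n + A) (1\<^sub>m n + B) P Q"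
    using wit assms(1) by (intro similar_mat_witI[of _ _ n]) auto
  then show ?thesis unfolding similar_mat_def by blast
qed

text \<open>\<open>A\<close> is similar to an upper triangular matrix by Schur. Its diagonal
  consists of eigenvalues of \<open>A\<close>, and the trace and \<open>det (1 + A)\<close>, both
  invariant under similarity, are read off from it.\<close>

lemma det_one_plus_eq_prod_eigenvalues:
  fixes A :: "complex mat"
  assumes "A \<in> carrier_mat n n"
  obtains l where "\<And>i. i < n \<Longrightarrow> l i \<in> spectrum A"
    "(\<Sum>i<n. l i) = (\<Sum>i<n. A $$ (i, i))"
    "det (1\<^sub>m n + A) = (\<Prod>i<n. 1 + l i)"
proof -
  from char_poly_factorized[OF assms] obtain as
    where "char_poly A = (\<Prod>a\<leftarrow>as. [:- a, 1:])" by blast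
  from schur_decomposition_exists[OF assms this] obtain B
    where B: "B \<in> carrier_mat n n" "upper_triangular B" and sim: "similar_mat A B"
    by blast
  have char_poly: "char_poly A = (\<Prod>a\<leftarrow>diag_mat B. [:- a, 1:])"
    using char_poly_similar[OF sim] char_poly_upper_triangular[OF B] by simp
  have spec: "B $$ (i, i) \<in> spectrum A" if "i < n" for i
  proof -
    have "B $$ (i, i) \<in> set (diag_mat B)"
      using that B(1) by (auto simp: diag_mat_def)
    then have "poly (char_poly A) (B $$ (i, i)) = 0"
      unfolding char_poly poly_prod_list by (auto simp: prod_list_zero_iff)
    then show ?thesis
      using spectrum_root_char_poly[OF assms] by simp
  qed
  have "det (1\<^sub>m n + A) = det (1\<^sub>m n + B)"
    using det_similar[OF similar_mat_one_plus[OF assms sim]] .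
  also have "\<dots> = prod_list (diag_mat (1\<^sub>m n + B))"
    using B by (intro det_upper_triangular[of _ n]) (auto simp: upper_triangular_def)
  also have "\<dots> = (\<Prod>i<n. 1 + B $$ (i, i))"
    using B(1) by (simp add: prod_list_diag_prod atLeast0LessThan)
  finally show thesis
    using that[of "\<lambda>i. B $$ (i, i)"] spec sum_diag_similar[OF assms sim] by simp
qed

lemma norm_det_one_plus_minus_one_le:
  fixes A :: "complex mat"
  assumes A: "A \<in> carrier_mat n n" and trace: "(\<Sum>i<n. A $$ (i, i)) = 0"
    and \<rho>: "\<rho> = spectral_radius A" "\<rho> < 1"
    and x: "x = - real n * ln (1 - \<rho>) * \<rho>"
  shows "0 \<le> x" "cmod (det (1\<^sub>m n + A) - 1) \<le> exp x - 1"
proof -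
  obtain l where l: "\<And>i. i < n \<Longrightarrow> l i \<in> spectrum A"
    "(\<Sum>i<n. l i) = (\<Sum>i<n. A $$ (i, i))"
    "det (1\<^sub>m n + A) = (\<Prod>i<n. 1 + l i)"
    using det_one_plus_eq_prod_eigenvalues[OF A] by metis
  have le: "cmod (l i) \<le> \<rho>" if "i < n" for i
    using that l(1) spectral_radius_mem_max(2)[OF A] \<rho>(1) by auto
  define z where "z = (\<Sum>i<n. Ln (1 + l i) - l i)"
  have det: "det (1\<^sub>m n + A) = exp z"
    unfolding l(3) z_def using l(2) trace le \<rho>(2)
    by (intro prod_one_plus_eq_exp_sum) force+
  have "cmod z \<le> (\<Sum>i<n. - \<rho> * ln (1 - \<rho>))"
    unfolding z_def using norm_Ln_one_plus_minus_self_le le \<rho>(2)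
    by (intro sum_norm_le) auto
  also have "\<dots> = x" by (simp add: x)
  finally have z: "cmod z \<le> x" .
  \<comment> \<open>Taking the sign from the bound on z avoids a separate case n = 0, where the
    spectrum is empty.\<close>
  then show "0 \<le> x" using norm_ge_zero[of z] by linarith
  show "cmod (det (1\<^sub>m n + A) - 1) \<le> exp x - 1"
    using norm_exp_minus_one_le[of z] z by (simp add: det order_trans)
qed

section \<open>Block diagonal matrices and the vanishing trace\<close>

lemma diag_block_mat_block_entries:
  fixes M :: "'a :: zero mat" and d :: "nat \<Rightarrow> nat"
  defines "D \<equiv> \<lambda>k. diag_block_mat (map (\<lambda>i. mat_block d M i i) [0..<k])"
  shows "\<exists>b. (\<forall>i < (\<Sum>l<k. d l). b i < k) \<and>
    D k \<in> carrier_mat (\<Sum>l<k. d l) (\<Sum>l<k. d l) \<and>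
    (\<forall>i < (\<Sum>l<k. d l). \<forall>j < (\<Sum>l<k. d l).
      D k $$ (i, j) = (if b i = b j then M $$ (i, j) else 0))"
proof (induction k)
  case 0
  show ?case by (simp add: D_def)
next
  case (Suc k)
  let ?s = "\<Sum>l<k. d l"
  from Suc obtain b where b: "\<And>i. i < ?s \<Longrightarrow> b i < k" and D: "D k \<in> carrier_mat ?s ?s"
    and entry: "\<And>i j. i < ?s \<Longrightarrow> j < ?s \<Longrightarrow>
      D k $$ (i, j) = (if b i = b j then M $$ (i, j) else 0)"
    by blast
  have block: "mat_block d M k k \<in> carrier_mat (d k) (d k)"
    by (simp add: mat_block_def)
  have D_Suc: "D (Suc k) = four_block_mat (D k) (0\<^sub>m ?s (d k)) (0\<^sub>m (d k) ?s) (mat_block d M k k)"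
    using D block unfolding D_def by (simp add: diag_block_mat_last)
  show ?case
  \<comment> \<open>\<open>b\<close> sends an index to the number of its block. Old labels are below
    k, so the label k of the appended block is fresh.\<close>
  proof (intro exI[of _ "\<lambda>i. if i < ?s then b i else k"] conjI allI impI)
    fix i assume "i < (\<Sum>l<Suc k. d l)"
    then show "(if i < ?s then b i else k) < Suc k" using b[of i] by auto
  next
    show "D (Suc k) \<in> carrier_mat (\<Sum>l<Suc k. d l) (\<Sum>l<Suc k. d l)"
      unfolding D_Suc using D block by simp
  next
    fix i j assume "i < (\<Sum>l<Suc k. d l)" "j < (\<Sum>l<Suc k. d l)"
    then show "D (Suc k) $$ (i, j) =
      (if (if i < ?s then b i else k) = (if j < ?s then b j else k) then M $$ (i, j) else 0)"
      unfolding D_Suc using D block entry[of i j] b[of i] b[of j]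
      by (auto simp: mat_block_def)
  qed
qed

text \<open>Replaces block sizes and offsets by a labelling \<open>b\<close> of the indices, the
  only form in which the partition is used below.\<close>

lemma block_diag_part_entries:
  fixes M :: "'a :: zero mat"
  assumes "(\<Sum>i<k. d i) = n"
  obtains b :: "nat \<Rightarrow> nat" where "block_diag_part k d M \<in> carrier_mat n n"
    "\<And>i j. i < n \<Longrightarrow> j < n \<Longrightarrow>
      block_diag_part k d M $$ (i, j) = (if b i = b j then M $$ (i, j) else 0)"
  using diag_block_mat_block_entries[where k = k and d = d and M = M] assms
  unfolding block_diag_part_def by metis

text \<open>Zeroing the entries of \<open>N\<close> outside the blocks gives another right inverse of \<open>D\<close>.\<close>

lemma right_inverse_block_diagonal:
  fixes D N :: "'a :: field mat"
  assumes D: "D \<in> carrier_mat n n" and N: "N \<in> carrier_mat n n" and DN: "D * N = 1\<^sub>m n"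
    and zero: "\<And>i j. i < n \<Longrightarrow> j < n \<Longrightarrow> b i \<noteq> b j \<Longrightarrow> D $$ (i, j) = 0"
    and ij: "i < n" "j < n" "b i \<noteq> b j"
  shows "N $$ (i, j) = 0"
proof -
  define N' where "N' = Matrix.mat n n (\<lambda>(i, j). if b i = b j then N $$ (i, j) else 0)"
  have N': "N' \<in> carrier_mat n n" by (simp add: N'_def)
  have "D * N' = 1\<^sub>m n"
  proof (rule eq_matI)
    fix p q assume "p < dim_row (1\<^sub>m n :: 'a mat)" "q < dim_col (1\<^sub>m n :: 'a mat)"
    then have pq: "p < n" "q < n" by auto
    have "(D * N') $$ (p, q) = (\<Sum>m<n. D $$ (p, m) * N' $$ (m, q))"
      using D N' pq by (auto simp: scalar_prod_def atLeast0LessThan)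
    \<comment> \<open>Only m with \<open>b m = b p\<close> contribute, and for these the cut-off in
      \<open>N'\<close> depends only on whether \<open>b p = b q\<close>.\<close>
    also have "\<dots> = (if b p = b q then (\<Sum>m<n. D $$ (p, m) * N $$ (m, q)) else 0)"
    proof (cases "b p = b q")
      case True
      then show ?thesis
        using zero[of p] pq by (auto simp: N'_def intro!: sum.cong)
    next
      case False
      then show ?thesis
        using zero[of p] pq by (auto simp: N'_def intro!: sum.neutral)
    qed
    also have "(\<Sum>m<n. D $$ (p, m) * N $$ (m, q)) = (D * N) $$ (p, q)"
      using D N pq by (auto simp: scalar_prod_def atLeast0LessThan)
    finally show "(D * N') $$ (p, q) = 1\<^sub>m n $$ (p, q)"
      using DN pq by auto
  qed (use D N' in auto)
  moreover have "N * D = 1\<^sub>m n"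
    using mat_mult_left_right_inverse[OF D N DN] .
  ultimately have "N' = N"
    using assoc_mult_mat[OF N D N'] N N' by simp
  moreover have "N' $$ (i, j) = 0" using ij by (simp add: N'_def)
  ultimately show ?thesis by simp
qed

text \<open>Every product in the diagonal sums vanishes: inside a block the off-diagonal part is
  zero, across blocks \<open>N\<close> is zero.\<close>

lemma sum_diag_block_off_part:
  fixes M N :: "'a :: field mat"
  assumes M: "M \<in> carrier_mat n n" and d: "(\<Sum>i<k. d i) = n"
    and N: "N \<in> carrier_mat n n" "block_diag_part k d M * N = 1\<^sub>m n"
  shows "(\<Sum>i<n. (N * block_off_part k d M) $$ (i, i)) = 0"
proof -
  obtain b :: "nat \<Rightarrow> nat" where D: "block_diag_part k d M \<in> carrier_mat n n"
    and entry: "\<And>i j. i < n \<Longrightarrow> j < n \<Longrightarrow>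
      block_diag_part k d M $$ (i, j) = (if b i = b j then M $$ (i, j) else 0)"
    using block_diag_part_entries[OF d] by metis
  have "N $$ (i, j) * block_off_part k d M $$ (j, i) = 0" if "i < n" "j < n" for i j
  proof (cases "b i = b j")
    case True
    then show ?thesis
      using that M D entry[of j i] by (simp add: block_off_part_def)
  next
    case False
    then show ?thesis
      using right_inverse_block_diagonal[OF D N, of b i j] entry that by simp
  qed
  moreover have "block_off_part k d M \<in> carrier_mat n n"
    using M D by (auto simp: block_off_part_def)
  ultimately show ?thesis
    using N(1) by (auto simp: scalar_prod_def intro!: sum.neutral)
qed

text \<open>An invertible matrix is a unit of the matrix ring, so \<open>mat_inverse\<close> returns
  \<open>Some\<close> and \<open>the\<close> is harmless.\<close>

lemma inv_mat_inverse:
  fixes A :: "'a :: field mat"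
  assumes A: "A \<in> carrier_mat n n" and inv: "invertible_mat A"
  shows "inv_mat A \<in> carrier_mat n n" "A * inv_mat A = 1\<^sub>m n"
proof -
  from inv obtain B where AB: "A * B = 1\<^sub>m n" and BA: "B * A = 1\<^sub>m (dim_row B)"
    using A unfolding invertible_mat_def inverts_mat_def by auto
  \<comment> \<open>The dimensions of \<open>B\<close> come from comparing column counts in both
    products.\<close>
  have "dim_row B = n" "dim_col B = n"
    using A arg_cong[OF BA, of dim_col] arg_cong[OF AB, of dim_col] by auto
  with AB BA A have "A \<in> Units (ring_mat TYPE('a) n ())"
    unfolding Units_def by (auto simp: ring_mat_simps intro!: bexI[of _ B])
  with mat_inverse(1)[OF A, where b = "()"] obtain C where C: "mat_inverse A = Some C" by blast
  show "inv_mat A \<in> carrier_mat n n" "A * inv_mat A = 1\<^sub>m n"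
    using mat_inverse(2)[OF A C] C by (auto simp: inv_mat_def)
qed

theorem theorem2p3:
  fixes M M_D M_off :: "complex mat" and n k :: nat and d :: "nat \<Rightarrow> nat" and \<rho> c :: real
  assumes "M \<in> carrier_mat n n"
    and "(\<Sum>i<k. d i) = n"
    and "M_D = block_diag_part k d M"
    and "M_off = block_off_part k d M"
    and "invertible_mat M_D"
    and "\<rho> = spectral_radius (inv_mat M_D * M_off)"
    and "\<rho> < 1"
    and "c = - real n * ln (1 - \<rho>)"
  shows "cmod (det M - det M_D) / cmod (det M_D) \<le> c * \<rho> * exp (c * \<rho>) \<and>
    (c * \<rho> < 1 \<longrightarrow> cmod (det M - det M_D) / cmod (det M_D) \<le> 7 / 4 * (c * \<rho>))"
proof -
  let ?N = "inv_mat M_D" and ?A = "inv_mat M_D * M_off"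
  have D: "M_D \<in> carrier_mat n n"
    using block_diag_part_entries[OF assms(2)] assms(3) by metis
  note N = inv_mat_inverse[OF D assms(5)]
  have off: "M_off \<in> carrier_mat n n"
    using D assms(1,3,4) by (auto simp: block_off_part_def)
  have A: "?A \<in> carrier_mat n n"
    using N off by simp
  \<comment> \<open>Factoring out \<open>M_D\<close> turns the relative error into
    \<open>cmod (det (1 + ?A) - 1)\<close>.\<close>
  have "M_D * (1\<^sub>m n + ?A) = M_D + M_D * ?A"
    using mult_add_distrib_mat[OF D one_carrier_mat A] D by simp
  also have "M_D * ?A = M_off"
    using assoc_mult_mat[OF D N(1) off] N off by simp
  also have "M_D + M_off = M"
    using D assms(1,3,4) by (auto simp: block_off_part_def)
  finally have det: "det M = det M_D * det (1\<^sub>m n + ?A)"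
    using det_mult[OF D, of "1\<^sub>m n + ?A"] A by simp
  have nonzero: "det M_D \<noteq> 0"
    using det_mult[OF D N(1)] N(2) by auto
  have "det M - det M_D = det M_D * (det (1\<^sub>m n + ?A) - 1)"
    by (simp add: det algebra_simps)
  then have quot: "cmod (det M - det M_D) / cmod (det M_D) = cmod (det (1\<^sub>m n + ?A) - 1)"
    using nonzero by (simp add: norm_mult)
  have "(\<Sum>i<n. ?A $$ (i, i)) = 0"
    using sum_diag_block_off_part[OF assms(1,2), of ?N] N assms(3,4) by simp
  note bound = norm_det_one_plus_minus_one_le[OF A this assms(6,7), of "c * \<rho>"]
  have "0 \<le> c * \<rho>" "cmod (det (1\<^sub>m n + ?A) - 1) \<le> exp (c * \<rho>) - 1"
    using bound assms(8) by auto
  then show ?thesis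
    unfolding quot
    using exp_minus_one_le_mult_exp[of "c * \<rho>"] exp_minus_one_le_linear[of "c * \<rho>"]
    by auto
qed

end
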